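(* Let $Y$ be a nonempty finite set, let $E=\{v_1,\dots,v_{|Y|}\}$ be the set of standard basis vectors of $\mathbb{R}^{|Y|}$, and let $U=\mathrm{conv}(E)$. Let $\{u_k\}_{k\ge1}$ be a sequence of points from $U$. For any sequence $\{e_k\}_{k\ge1}$ of points from $E$ and every $k=1,2,\dots$ we have $$\left\|\sum_{i=1}^k(u_i-e_i)\right\|_2\le\gamma_k C,$$ where $s_k=\sum_{i=1}^k(u_i-e_i)$, $\gamma_k=-\min_{j\in\{1,\dots,|Y|\}}s_k(j)$ and $C=\sqrt{|Y|}\,(|Y|-1)$.
   Context: $s_k(j)$ denotes the $j$-th component of the vector $s_k\in\mathbb{R}^{|Y|}$. The set $Y$ (a finite collection of points from $\mathbb{R}^n$, the discrete actions) enters only through its cardinality $|Y|$. *)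

theory Defs
  imports "HOL-Analysis.Analysis"
begin

(* A finite type 'y plays the role of Y, so real ^ 'y is R^|Y| and CARD('y) is |Y|. *)

definition simplex_vertices :: "(real ^ 'y) set"
  where "simplex_vertices = range (\<lambda>j. axis j 1)"

definition error_sum :: "(nat \<Rightarrow> real ^ 'y) \<Rightarrow> (nat \<Rightarrow> real ^ 'y) \<Rightarrow> nat \<Rightarrow> real ^ 'y"
  where "error_sum u e k = (\<Sum>i = 1..k. u i - e i)"

definition neg_min_component :: "real ^ 'y \<Rightarrow> real"
  where "neg_min_component s = - Min (range (\<lambda>j. s $ j))"

end

theory Submission
  imports Defs
begin

text \<open>The components of a point of the simplex sum to 1, so those of the error sum
  \<open>s\<close> sum to 0. Hence every component of \<open>s\<close> is minus the sum of the others, each of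
  which is at least \<open>- \<gamma>\<close>, and so lies between \<open>- \<gamma>\<close> and \<open>(|Y| - 1) * \<gamma>\<close>.
  If \<open>|Y| = 1\<close> then \<open>s = 0\<close>; otherwise \<open>\<gamma> \<le> (|Y| - 1) * \<gamma>\<close>, so the latter bounds
  all components in absolute value.\<close>

text \<open>The equation cuts out a hyperplane, which is convex and contains every vertex, hence the
  whole hull.\<close>

lemma sum_components_simplex:
  fixes x :: "real ^ 'y"
  assumes "x \<in> convex hull simplex_vertices"
  shows "(\<Sum>j\<in>UNIV. x $ j) = 1"
proof -
  have "convex hull simplex_vertices \<subseteq> {x :: real ^ 'y. 1 \<bullet> x = 1}"
    by (intro hull_minimal convex_hyperplane)
      (auto simp: simplex_vertices_def inner_axis)
  then show ?thesis
    using assms by (auto simp: inner_vec_def)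
qed

text \<open>After exchanging the sums, each difference \<open>u i - e i\<close> contributes 1 - 1,
  since a vertex also lies in the hull.\<close>

lemma sum_components_error_sum:
  fixes u e :: "nat \<Rightarrow> real ^ 'y"
  assumes "\<And>i. i \<ge> 1 \<Longrightarrow> u i \<in> convex hull simplex_vertices"
    and "\<And>i. i \<ge> 1 \<Longrightarrow> e i \<in> simplex_vertices"
  shows "(\<Sum>j\<in>UNIV. error_sum u e k $ j) = 0"
proof -
  have "(\<Sum>j\<in>UNIV. error_sum u e k $ j) = (\<Sum>i = 1..k. \<Sum>j\<in>UNIV. (u i - e i) $ j)"
    unfolding error_sum_def sum_component by (rule sum.swap)
  also have "\<dots> = 0"
    using assms by (auto intro!: sum.neutral simp: sum_subtractf sum_components_simplex hull_inc)
  finally show ?thesis .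
qed

lemma component_ge_neg_min_component: "- neg_min_component s \<le> s $ j"
  unfolding neg_min_component_def minus_minus by (rule Min_le) auto

lemma abs_component_le_of_sum_zero:
  fixes s :: "real ^ 'y"
  assumes "(\<Sum>j\<in>UNIV. s $ j) = 0"
  shows "\<bar>s $ j\<bar> \<le> neg_min_component s * (real CARD('y) - 1)"
proof -
  let ?g = "neg_min_component s"
  have rest: "s $ j = - (\<Sum>i\<in>UNIV - {j}. s $ i)"
    using assms by (simp add: sum.remove[of UNIV j])
  have "real (card (UNIV - {j})) * (- ?g) \<le> (\<Sum>i\<in>UNIV - {j}. s $ i)"
    by (intro sum_bounded_below component_ge_neg_min_component)
  then have upper: "s $ j \<le> ?g * (real CARD('y) - 1)"
    using rest by (simp add: of_nat_diff algebra_simps)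
  show ?thesis
  proof (cases "UNIV = {j}")
    case True
    then have "s $ j = 0"
      using rest by simp
    moreover have "CARD('y) = 1"
      by (subst True) simp
    ultimately show ?thesis by simp
  next
    case False
    then have "1 < CARD('y)"
      by (metis UNIV_I card_1_singletonE finite_UNIV_card_ge_0 finite less_one linorder_neqE_nat
          not_less_zero singletonD)
    \<comment> \<open>The components total 0 and each is at least \<open>- ?g\<close>, so
      \<open>- ?g\<close> cannot be positive.\<close>
    moreover have "0 \<le> ?g"
    proof -
      have "real CARD('y) * (- ?g) \<le> (\<Sum>i\<in>UNIV. s $ i)"
        by (intro sum_bounded_below component_ge_neg_min_component)
      then show ?thesis
        using assms by (simp add: zero_le_mult_iff)
    qed
    ultimately have "?g * 1 \<le> ?g * (real CARD('y) - 1)"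
      by (intro mult_left_mono) auto
    then show ?thesis
      using upper component_ge_neg_min_component[of s j] by linarith
  qed
qed

text \<open>The norm is monotone in the absolute values of the components, so the constant vector
  \<open>vec b\<close> gives the bound.\<close>

lemma norm_le_sqrt_card_mult:
  fixes x :: "real ^ 'y"
  assumes "\<And>j. \<bar>x $ j\<bar> \<le> b"
  shows "norm x \<le> sqrt (real CARD('y)) * b"
proof -
  \<comment> \<open>Some index exists because types are nonempty. The sign turns
    \<open>sqrt (b\<^sup>2)\<close> into \<open>b\<close> rather than its absolute value.\<close>
  have "0 \<le> b"
    using assms abs_ge_zero order_trans by blast
  have "norm x \<le> norm (vec b :: real ^ 'y)"
    using assms by (intro norm_le_componentwise_cart) (auto intro: order_trans[OF _ abs_ge_self])
  also have "\<dots> = sqrt (real CARD('y)) * b"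
    using \<open>0 \<le> b\<close> by (simp add: norm_vec_def L2_set_def real_sqrt_mult)
  finally show ?thesis .
qed

theorem theorem5:
  fixes u e :: "nat \<Rightarrow> real ^ 'y" and k :: nat
  assumes "\<And>i. i \<ge> 1 \<Longrightarrow> u i \<in> convex hull simplex_vertices"
    and "\<And>i. i \<ge> 1 \<Longrightarrow> e i \<in> simplex_vertices"
    and "k \<ge> 1"
  shows "norm (error_sum u e k)
    \<le> neg_min_component (error_sum u e k) * (sqrt (real CARD('y)) * (real CARD('y) - 1))"
proof -
  have "(\<Sum>j\<in>UNIV. error_sum u e k $ j) = 0"
    using assms(1,2) by (rule sum_components_error_sum)
  from norm_le_sqrt_card_mult[OF abs_component_le_of_sum_zero[OF this]]
  show ?thesis
    by (simp add: mult.left_commute)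
qed

end
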